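(* Let $p$ be an odd prime with $p \equiv 2 \pmod 3$, and let $c = 0$. For a positive integer $n$, let $M_n = [m_{ij}]_{1 \le i,j \le n}$ be the $n \times n$ matrix with entries $m_{ij} = \left[ \frac{j-i+c}{p} \right]$. Then for every $n$ with $1 \le n \le p$, $\det(M_n) = (-1)^{n-1}(n-1)$.
   Context: For an odd prime $p$ and an integer $a$, the cubic residue symbol is defined by $\left[ \frac{a}{p} \right] = 1$ if $a \not\equiv 0 \pmod p$ and $x^3 \equiv a \pmod p$ has an integer solution; $\left[ \frac{a}{p} \right] = -1$ if $x^3 \equiv a \pmod p$ has no integer solution; and $\left[ \frac{a}{p} \right] = 0$ if $a \equiv 0 \pmod p$. *)

theory Defs
  imports "HOL-Number_Theory.Cong" "Jordan_Normal_Form.Determinant"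
begin

definition cubic_residue_symbol :: "int \<Rightarrow> nat \<Rightarrow> int" where
  "cubic_residue_symbol a p =
     (if [a = 0] (mod int p) then 0
      else if (\<exists>x::int. [x ^ 3 = a] (mod int p)) then 1
      else -1)"

text \<open>
  Matrix indices start at 0 here, rather than at 1. The entry depends only on the difference
  of the indices (taken in the integers, so possibly negative), hence the matrix is the same.
\<close>
definition cubic_residue_matrix :: "nat \<Rightarrow> int \<Rightarrow> nat \<Rightarrow> int mat" where
  "cubic_residue_matrix p c n =
     mat n n (\<lambda>(i, j). cubic_residue_symbol (int j - int i + c) p)"

end

theory Submission
  imports Defs "HOL-Number_Theory.Residues"
begin

text \<open>
  Since 3 is coprime to \<open>p - 1\<close>, cubing permutes the residues modulo \<open>p\<close>, so every entry off the
  diagonal is 1, and the matrix is \<open>J - I\<close> with \<open>J\<close> the all-ones matrix.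
\<close>

text \<open>The root is explicit: with \<open>p = 3 * k + 2\<close>, Fermat's little theorem shows
  that \<open>b ^ (2 * k + 1)\<close> is a cube root of any \<open>b\<close> prime to
  \<open>p\<close>.\<close>

lemma cube_root_mod_prime_ex:
  fixes a :: int
  assumes p: "prime p" and p2: "[p = 2] (mod 3)"
  shows "\<exists>x. [x ^ 3 = a] (mod int p)"
proof (cases "[a = 0] (mod int p)")
  case True
  then have "[0 ^ 3 = a] (mod int p)"
    by (simp add: cong_sym_eq)
  then show ?thesis ..
next
  case False
  define k where "k = p div 3"
  have "p mod 3 = 2"
    using p2 by (simp add: cong_def)
  then have pk: "p = 3 * k + 2"
    unfolding k_def by presburger
  have pos: "int p > 0"
    using p by (simp add: prime_gt_0_nat)
  \<comment> \<open>\<open>fermat_theorem\<close> is about natural numbers, so \<open>a\<close> is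
    replaced by its least nonnegative residue.\<close>
  define b where "b = nat (a mod int p)"
  have b: "int b = a mod int p"
    using pos by (simp add: b_def)
  then have ba: "[int b = a] (mod int p)"
    by simp
  have "\<not> p dvd b"
    using False b by (simp add: cong_0_iff dvd_mod_iff flip: int_dvd_int_iff)
  then have "[b ^ (p - 1) = 1] (mod p)"
    using p by (rule fermat_theorem[rotated])
  \<comment> \<open>Squaring makes the total exponent
    \<open>2 * (p - 1) + 1 = 3 * (2 * k + 1)\<close>, a multiple of 3; without it the exponent would
    be \<open>p\<close>, which is 2 modulo 3.\<close>
  then have "[(b ^ (p - 1)) ^ 2 * b = 1 ^ 2 * b] (mod p)"
    by (intro cong_mult cong_pow) auto
  moreover have "(b ^ (p - 1)) ^ 2 * b = (b ^ (2 * k + 1)) ^ 3"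
    unfolding pk power_mult[symmetric] power_Suc2[symmetric]
    by (rule arg_cong[of _ _ "power b"]) simp
  ultimately have "[(b ^ (2 * k + 1)) ^ 3 = b] (mod p)"
    by simp
  then have "[int (b ^ (2 * k + 1)) ^ 3 = int b] (mod int p)"
    by (simp only: cong_int_iff flip: of_nat_power)
  then show ?thesis
    using ba cong_trans by blast
qed

text \<open>
  Adding all rows to the first one (left multiplication by \<open>L\<close>) makes the first row constant,
  and right multiplication by the inverse of \<open>L\<close> then yields the lower triangular matrix \<open>T\<close>.
\<close>

lemma det_mat_constant_diagonal_off_diagonal:
  fixes x y :: "'a :: comm_ring_1"
  assumes n: "1 \<le> n"
  shows "det (mat n n (\<lambda>(i, j). if i = j then x else y)) =
    (x - y) ^ (n - 1) * (x + of_nat (n - 1) * y)"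
proof -
  define A where "A = mat n n (\<lambda>(i, j). if i = j then x else y)"
  define s where "s = x + of_nat (n - 1) * y"
  define L where "L = mat n n (\<lambda>(i, j). if i = 0 \<or> i = j then 1 else (0 :: 'a))"
  define T where "T = mat n n (\<lambda>(i, j).
    if j = 0 then if i = 0 then s else y else if i = j then x - y else 0)"
  have carrier: "A \<in> carrier_mat n n" "L \<in> carrier_mat n n" "T \<in> carrier_mat n n"
    by (simp_all add: A_def L_def T_def)
  have col_sum: "(\<Sum>k = 0..<n. if k = j then x else y) = s" if "j < n" for j
  proof -
    have "(\<Sum>k = 0..<n. if k = j then x else y) = x + (\<Sum>k \<in> {0..<n} - {j}. y)"
      using that by (subst sum.remove[of _ j]) (auto intro!: sum.cong)
    then show ?thesis
      using that by (simp add: s_def)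
  qed
  \<comment> \<open>This form of the similarity avoids inverting \<open>L\<close>;
    \<open>det L = 1\<close> then cancels on both sides.\<close>
  have "L * A = T * L"
  proof (rule eq_matI)
    fix i j assume "i < dim_row (T * L)" "j < dim_col (T * L)"
    then have ij: "i < n" "j < n"
      by (simp_all add: L_def T_def)
    have LA: "(L * A) $$ (i, j) =
        (\<Sum>k = 0..<n. (if i = 0 \<or> i = k then 1 else 0) * (if k = j then x else y))"
      using ij by (simp add: L_def A_def scalar_prod_def)
    have TL: "(T * L) $$ (i, j) =
        (\<Sum>k = 0..<n. (if k = 0 then if i = 0 then s else y else if i = k then x - y else 0) *
           (if k = 0 \<or> k = j then 1 else 0))"
      using ij by (simp add: L_def T_def scalar_prod_def)
    show "(L * A) $$ (i, j) = (T * L) $$ (i, j)"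
    proof (cases "i = 0")
      case True
      have "(T * L) $$ (i, j) = (\<Sum>k = 0..<n. if k = 0 then s else 0)"
        unfolding TL using True by (intro sum.cong) auto
      then show ?thesis
        unfolding LA using True ij by (simp add: col_sum)
    next
      case False
      have "(L * A) $$ (i, j) = (\<Sum>k = 0..<n. if k = i then if i = j then x else y else 0)"
        unfolding LA using False by (intro sum.cong) auto
      \<comment> \<open>Row \<open>i\<close> of \<open>T\<close> has nonzero entries at most in
        columns 0 and \<open>i\<close>. The first always meets a 1 of \<open>L\<close>, the second
        only if \<open>i = j\<close>.\<close>
      moreover have "(T * L) $$ (i, j) = (\<Sum>k = 0..<n. (if k = 0 then y else 0) +
          (if k = i then if i = j then x - y else 0 else 0))"
        unfolding TL using False by (intro sum.cong) auto
      ultimately show ?thesis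
        using ij by (simp add: sum.distrib)
    qed
  qed (simp_all add: A_def L_def T_def)
  then have "det L * det A = det T * det L"
    using carrier by (metis det_mult)
  moreover have "det L = 1"
  proof -
    have "det L = prod_list (diag_mat L)"
      using carrier by (intro det_upper_triangular) (auto simp: L_def)
    then show ?thesis
      by (simp add: prod_list_diag_prod L_def)
  qed
  moreover have "det T = s * (x - y) ^ (n - 1)"
  proof -
    have "det T = prod_list (diag_mat T)"
      using carrier by (intro det_lower_triangular[where n = n]) (auto simp: T_def)
    also have "\<dots> = (\<Prod>i = 0..<n. if i = 0 then s else x - y)"
      by (auto simp: prod_list_diag_prod T_def intro!: prod.cong)
    also have "\<dots> = s * (\<Prod>i \<in> {0..<n} - {0}. x - y)"
      using n by (subst prod.remove[of _ 0]) (auto intro!: prod.cong)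
    finally show ?thesis
      using n by simp
  qed
  ultimately show ?thesis
    by (simp add: A_def s_def mult.commute)
qed

theorem theorem3p1:
  fixes p n :: nat and c :: int
  assumes "prime p" and "odd p" and "[p = 2] (mod 3)"
    and "c = 0"
    and "1 \<le> n" and "n \<le> p"
  shows "det (cubic_residue_matrix p c n) = (-1) ^ (n - 1) * (int n - 1)"
proof -
  \<comment> \<open>Since \<open>n \<le> p\<close>, the indices are distinct residues, so zeros
    occur only on the diagonal.\<close>
  have "[int j - int i = 0] (mod int p) \<longleftrightarrow> i = j" if "i < n" "j < n" for i j
  proof -
    have "[int j - int i = 0] (mod int p) \<longleftrightarrow> [j = i] (mod p)"
      by (simp add: cong_diff_iff_cong_0 cong_int_iff)
    then show ?thesis
      using that \<open>n \<le> p\<close> by (auto simp: cong_def)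
  qed
  then have "cubic_residue_matrix p c n = mat n n (\<lambda>(i, j). if i = j then 0 else 1)"
    using cube_root_mod_prime_ex[OF \<open>prime p\<close> \<open>[p = 2] (mod 3)\<close>] \<open>c = 0\<close>
    by (auto simp: cubic_residue_matrix_def cubic_residue_symbol_def intro!: eq_matI)
  \<comment> \<open>The determinant formula is used with \<open>x = 0\<close> and
    \<open>y = 1\<close>.\<close>
  then show ?thesis
    using \<open>1 \<le> n\<close> by (simp add: det_mat_constant_diagonal_off_diagonal of_nat_diff)
qed

end
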